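(* Let $b$ be a prime. For every $1\le p<\infty$ there exists a constant $C_p>0$ (independent of $m$) such that for every $m\in\mathbb{N}$ the two-dimensional symmetrized Hammersley point set $P_H^{\mathrm{sym}}$ in base $b$, consisting of $N=b^{m+2}$ points, satisfies $$L_p(P_H^{\mathrm{sym}})\le C_p\frac{\sqrt{m+2}}{b^{m+2}}=C_p\frac{\sqrt{\log_b N}}{N}.$$ That is, for all $1\le p<\infty$ the $L_p$ discrepancy of $P_H^{\mathrm{sym}}$ is of the best possible order.
   Context: For $a,a'\in\{0,1,\dots,b-1\}$, $a\oplus a'$ denotes the sum modulo $b$, taken in $\{0,\dots,b-1\}$. For $m\in\mathbb{N}$ (positive integer), the two-dimensional symmetrized Hammersley point set in base $b$ is the multiset of $b^{m+2}$ points (counted with multiplicity) $$P_H^{\mathrm{sym}}=\{(x_{\boldsymbol a},y_{\boldsymbol a}):\boldsymbol a=(a_1,\dots,a_{m+2})\in\{0,1,\dots,b-1\}^{m+2}\},$$ $$x_{\boldsymbol a}=\frac{a_1\oplus a_{m+1}}{b}+\dots+\frac{a_m\oplus a_{m+1}}{b^m}+\frac{a_{m+1}}{b^{m+1}}+\frac{a_{m+1}}{b^{m+2}}+\cdots,$$ $$y_{\boldsymbol a}=\frac{a_m\oplus a_{m+2}}{b}+\dots+\frac{a_1\oplus a_{m+2}}{b^m}+\frac{a_{m+2}}{b^{m+1}}+\frac{a_{m+2}}{b^{m+2}}+\cdots.$$ For a finite point set $P\subset[0,1]^2$ (counted with multiplicity) the local discrepancy function is $\Delta(\boldsymbol t;P)=\frac1{|P|}\sum_{\boldsymbol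 x\in P}1_{[\boldsymbol0,\boldsymbol t)}(\boldsymbol x)-t_1t_2$ for $\boldsymbol t=(t_1,t_2)\in[0,1]^2$, where $1_{[\boldsymbol0,\boldsymbol t)}$ is the characteristic function of $[0,t_1)\times[0,t_2)$. For $1\le p<\infty$, $L_p(P)=\left(\int_{[0,1]^2}|\Delta(\boldsymbol t;P)|^p\,\mathrm{d}\boldsymbol t\right)^{1/p}$. "Best possible order" refers to the known general lower bound of order $\sqrt{\log N}/N$ for the $L_p$ discrepancy of $N$-point sets in $[0,1]^2$; the precise content of the claim is the displayed upper bound. *)

theory Defs
  imports
    "HOL-Analysis.Analysis"
    "HOL-Library.Multiset"
    "HOL-Library.FuncSet"
    "HOL-Computational_Algebra.Primes"
begin

definition digit_add :: "nat \<Rightarrow> nat \<Rightarrow> nat \<Rightarrow> nat" where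
  "digit_add b a a' = (a + a') mod b"

text \<open>Digit vectors are functions \<open>a\<close> on the index set \<open>{1..m+2}\<close>, so that indices agree with the
  subscripts of the usual notation.\<close>

definition hammersley_x :: "nat \<Rightarrow> nat \<Rightarrow> (nat \<Rightarrow> nat) \<Rightarrow> real" where
  "hammersley_x b m a =
     (\<Sum>i=1..m. real (digit_add b (a i) (a (m+1))) / real b ^ i)
     + (\<Sum>k. real (a (m+1)) / real b ^ (m+1+k))"

definition hammersley_y :: "nat \<Rightarrow> nat \<Rightarrow> (nat \<Rightarrow> nat) \<Rightarrow> real" where
  "hammersley_y b m a =
     (\<Sum>i=1..m. real (digit_add b (a (m+1-i)) (a (m+2))) / real b ^ i)
     + (\<Sum>k. real (a (m+2)) / real b ^ (m+1+k))"

definition sym_hammersley :: "nat \<Rightarrow> nat \<Rightarrow> (real \<times> real) multiset" where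
  "sym_hammersley b m =
     image_mset (\<lambda>a. (hammersley_x b m a, hammersley_y b m a))
       (mset_set ({1..m+2} \<rightarrow>\<^sub>E {0..<b}))"

definition local_disc :: "(real \<times> real) multiset \<Rightarrow> real \<times> real \<Rightarrow> real" where
  "local_disc P t =
     1 / real (size P) * (\<Sum>x\<in>#P. indicator ({0..<fst t} \<times> {0..<snd t}) x) - fst t * snd t"

definition Lp_disc :: "real \<Rightarrow> (real \<times> real) multiset \<Rightarrow> real" where
  "Lp_disc p P =
     (LINT t:{0..1} \<times> {0..1}|lborel. \<bar>local_disc P t\<bar> powr p) powr (1 / p)"

text \<open>The series and the integral above are total functions of the library with a junk value in the
  divergent or non-integrable case. The next two facts show that this case does not arise.\<close>

lemma summable_digit_tail:
  assumes "2 \<le> b"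
  shows "summable (\<lambda>k. real d / real b ^ (n + k))"
proof -
  have "summable (\<lambda>k. real d / real b ^ n * (1 / real b) ^ k)"
    using assms by (intro summable_mult summable_geometric) auto
  then show ?thesis
    by (simp add: power_add power_divide)
qed

lemma local_disc_measurable [measurable]: "local_disc P \<in> borel_measurable borel"
proof -
  have "(\<lambda>t::real\<times>real. \<Sum>x\<in>#P. indicator ({0..<fst t} \<times> {0..<snd t}) x :: real)
          \<in> borel_measurable borel"
  proof (induction P)
    case (add x P)
    have "(\<lambda>t::real\<times>real. indicator ({0..<fst t} \<times> {0..<snd t}) x :: real) =
        (\<lambda>t. if 0 \<le> fst x \<and> fst x < fst t \<and> 0 \<le> snd x \<and> snd x < snd t then 1 else 0)"
      by (auto simp: indicator_def mem_Times_iff fun_eq_iff)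
    also have "\<dots> \<in> borel_measurable borel"
      unfolding borel_prod[symmetric] by measurable
    finally show ?case
      using add by simp
  qed simp
  then show ?thesis
    unfolding local_disc_def[abs_def] borel_prod[symmetric] by measurable
qed

lemma set_integrable_local_disc:
  assumes "0 \<le> p"
  shows "set_integrable lborel ({0..1} \<times> {0..1}) (\<lambda>t. \<bar>local_disc P t\<bar> powr p)"
proof -
  have bound: "norm (\<bar>local_disc P t\<bar> powr p) \<le> 2 powr p"
    if t: "t \<in> {0..1} \<times> {0..1}" for t
  proof -
    let ?s = "\<Sum>x\<in>#P. indicator ({0..<fst t} \<times> {0..<snd t}) x :: real"
    have s: "0 \<le> ?s \<and> ?s \<le> real (size P)"
      by (induction P) (auto simp: indicator_def)
    have "0 \<le> 1 / real (size P) * ?s" "1 / real (size P) * ?s \<le> 1"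
      using s by (auto simp: divide_le_eq_1 nonempty_has_size[symmetric])
    moreover have "0 \<le> fst t * snd t" "fst t * snd t \<le> 1"
      using t by (auto simp: mem_Times_iff intro: mult_le_one)
    ultimately have "\<bar>local_disc P t\<bar> \<le> 2"
      unfolding local_disc_def by linarith
    then show ?thesis
      using assms by (simp add: powr_mono2)
  qed
  have "emeasure lborel ({0..1::real} \<times> {0..1::real}) < \<infinity>"
    by (rule emeasure_bounded_finite) (auto intro: bounded_Times)
  moreover have "({0..1::real} \<times> {0..1::real}) \<in> sets lborel"
    by (simp add: borel_closed closed_Times)
  moreover have "(\<lambda>t. \<bar>local_disc P t\<bar> powr p) \<in> borel_measurable lborel"
    by measurable
  ultimately show ?thesis
    unfolding set_integrable_def
    by (intro integrableI_bounded_set_indicator[where B = "2 powr p"])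
       (use bound in auto)
qed

end

theory Submission
  imports Defs
begin

text \<open>Multiply every coordinate by \<open>b ^ m\<close> and take the integer formed by the first \<open>m\<close> digits.
  Each symmetrized point then becomes a pair \<open>(X, Y)\<close> of numbers below \<open>b ^ m\<close>, and \<open>Y\<close> is
  obtained from \<open>X\<close> by reversing the digits and shifting all of them by the same
  \<open>d = a\<^sub>m\<^sub>+\<^sub>2 - a\<^sub>m\<^sub>+\<^sub>1\<close> modulo \<open>b\<close>; every \<open>d\<close> occurs equally often. Rounding the
  corner of the test box to the grid of mesh \<open>b ^ -m\<close> costs only a bounded number of points, so
  it suffices to control the counting error \<open>excess b m J K\<close> at a grid corner \<open>(J, K)\<close>, in mean over
  the grid.

  Choose \<open>(J, K)\<close> uniformly and reveal the digits of \<open>J\<close> from the most significant one and, in the same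
  rhythm, the digits of \<open>K\<close> from the least significant one: \<open>(J, K)\<close> turns into
  \<open>(b * J + j, e * b ^ u + K)\<close> with \<open>j, e\<close> uniform in \<open>{..<b}\<close>. The points
  whose first coordinate has a prefix below \<open>J\<close> reproduce the previous excess, so
  one step changes the excess by a sum of \<open>j\<close> values of the function
  \<open>defect b u J K\<close> of the shift (lemma \<open>excess_Suc\<close>). This change is bounded but has a nonzero mean,
  proportional to the sum of the defect over all shifts. Averaging over shifts makes the latter sum contract: its
  next value is a single value of the present defect (lemma \<open>sum_defect_Suc\<close>), hence it shrinks by the
  factor \<open>b\<close> in mean. Adding half of this bounded sum to the excess therefore compensates the drift exactly,
  and the resulting \<open>corrected_excess\<close> is a martingale with increments of size at most \<open>2 * b\<close>
  (lemmas \<open>corrected_excess_Suc\<close>, \<open>sum_increment\<close>, \<open>abs_increment_le\<close>).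

  After \<open>m\<close> steps such a martingale has size about \<open>sqrt m\<close>, and the usual exponential-moment argument
  of Azuma and Hoeffding makes this precise (lemma \<open>sum_exp_normalized_le\<close>): the exponential of the
  corrected excess, divided by \<open>2 * b * sqrt m\<close>, has mean at most \<open>exp 1\<close>, and so has its
  reciprocal. Exponential moments dominate all \<open>p\<close>-th moments, which gives the bound for every \<open>p\<close>
  at once.\<close>

section \<open>Digits and sums over digits\<close>

lemma sum_lessThan_mult:
  fixes F :: "nat \<Rightarrow> 'a::comm_monoid_add"
  shows "(\<Sum>n<b * q. F n) = (\<Sum>n<q. \<Sum>c<b. F (b * n + c))"
proof -
  have "(\<Sum>n<q. \<Sum>c<b. F (b * n + c)) = (\<Sum>n<q. sum F {n * b..<n * b + b})"
    by (rule sum.cong[OF refl])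
       (simp add: sum.shift_bounds_nat_ivl[of F 0 "n * b" b for n, simplified] lessThan_atLeast0 mult.commute add.commute)
  then show ?thesis
    by (simp add: sum.nat_group mult.commute)
qed

lemma add_mod_eq_iff:
  assumes "c < b" "e < b" "d < (b::nat)"
  shows "(c + d) mod b = e \<longleftrightarrow> d = (e + (b - c)) mod b"
proof (cases "c + d < b")
  case True
  then show ?thesis using assms by (cases "e < c") (auto simp: mod_if)
next
  case False
  then show ?thesis using assms by (cases "e < c") (auto simp: mod_if)
qed

lemma sum_mod_shift:
  fixes F :: "nat \<Rightarrow> 'a::comm_monoid_add"
  assumes "0 < b"
  shows "(\<Sum>y<b. F ((y + r) mod b)) = (\<Sum>c<b. F c)"
proof -
  have "inj_on (\<lambda>y. (y + r) mod b) {..<b}"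
  proof (rule inj_onI)
    fix x y assume *: "x \<in> {..<b}" "y \<in> {..<b}" "(x + r) mod b = (y + r) mod b"
    have "z = ((x + r) mod b + (b - r mod b)) mod b"
      if "z \<in> {..<b}" "(z + r) mod b = (x + r) mod b" for z
      using that assms add_mod_eq_iff[of "r mod b" b "(x + r) mod b" z] by (simp add: mod_simps add.commute)
    then show "x = y" using * by metis
  qed
  moreover have "(\<lambda>y. (y + r) mod b) ` {..<b} \<subseteq> {..<b}"
    using assms by auto
  ultimately have "bij_betw (\<lambda>y. (y + r) mod b) {..<b} {..<b}"
    by (simp add: bij_betw_def endo_inj_surj)
  then show ?thesis
    by (rule sum.reindex_bij_betw)
qed

lemma digit_less_iff:
  assumes "x < q" "y < (q::nat)"
  shows "c * q + x < e * q + y \<longleftrightarrow> c < e \<or> (c = e \<and> x < y)"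
proof -
  have "c * q + x < e * q + y" if "c < e"
  proof -
    have "(c + 1) * q \<le> e * q" using that by (intro mult_le_mono1) auto
    then show ?thesis using assms by simp
  qed
  moreover have "e * q + y < c * q + x" if "e < c"
  proof -
    have "(e + 1) * q \<le> c * q" using that by (intro mult_le_mono1) auto
    then show ?thesis using assms by simp
  qed
  ultimately show ?thesis by (cases c e rule: linorder_cases) auto
qed

lemma sum_of_bool_less: "e \<le> b \<Longrightarrow> (\<Sum>c<b. of_bool (c < e)) = real e"
  by (simp add: sum_of_bool_eq) (metis Int_absorb1 card_lessThan lessThan_def lessThan_subset_iff)

text \<open>New digits are appended to \<open>J\<close> and prepended to \<open>K\<close>, because the digit reversal matches the
  leading digits of \<open>J\<close> with the trailing digits of \<open>K\<close>.\<close>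
lemma sum_grid_Suc:
  fixes F :: "nat \<Rightarrow> nat \<Rightarrow> real"
  shows "(\<Sum>J<b^Suc u. \<Sum>K<b^Suc u. F J K) =
    (\<Sum>J<b^u. \<Sum>j<b. \<Sum>e<b. \<Sum>K<b^u. F (b * J + j) (e * b ^ u + K))"
proof -
  have K: "(\<Sum>K<b^Suc u. G K) = (\<Sum>e<b. \<Sum>K<b^u. G (e * b ^ u + K))" for G :: "nat \<Rightarrow> real"
    using sum_lessThan_mult[of G "b ^ u" b] by (simp add: mult.commute)
  have J: "(\<Sum>J<b^Suc u. G J) = (\<Sum>J<b^u. \<Sum>j<b. G (b * J + j))" for G :: "nat \<Rightarrow> real"
    using sum_lessThan_mult[of G b "b ^ u"] by simp
  show ?thesis
    unfolding J[of "\<lambda>J. \<Sum>K<b^Suc u. F J K"] by (simp only: K)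
qed

section \<open>The counting error at grid points\<close>

text \<open>Reverses the order of the last \<open>u\<close> base-\<open>b\<close> digits of \<open>X\<close> and adds \<open>d\<close>
  to each of them modulo \<open>b\<close>.\<close>
fun shifted_reversal :: "nat \<Rightarrow> nat \<Rightarrow> nat \<Rightarrow> nat \<Rightarrow> nat" where
  "shifted_reversal b d 0 X = 0"
| "shifted_reversal b d (Suc u) X = ((X + d) mod b) * b ^ u + shifted_reversal b d u (X div b)"

text \<open>For one shift \<open>d\<close>, the error made in the strip of points with first coordinate \<open>J\<close>
  when the indicator of \<open>Y < K\<close> is replaced by its mean.\<close>
definition defect :: "nat \<Rightarrow> nat \<Rightarrow> nat \<Rightarrow> nat \<Rightarrow> nat \<Rightarrow> real" where
  "defect b u J K d = of_bool (shifted_reversal b d u J < K) - real K / real b ^ u"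

text \<open>The number of points below \<open>(J, K)\<close> minus its expected value, for the union over all shifts
  \<open>d\<close> of the \<open>b ^ u\<close>-point sets of pairs formed by \<open>X\<close> and its shifted reversal.\<close>
definition excess :: "nat \<Rightarrow> nat \<Rightarrow> nat \<Rightarrow> nat \<Rightarrow> real" where
  "excess b u J K =
     (\<Sum>d<b. \<Sum>X<J. of_bool (shifted_reversal b d u X < K)) - real b * real J * real K / real b ^ u"

text \<open>The weight \<open>1/2\<close> is the one for which the drift of the excess is cancelled, see
  \<open>sum_increment\<close>.\<close>
definition corrected_excess :: "nat \<Rightarrow> nat \<Rightarrow> nat \<Rightarrow> nat \<Rightarrow> real" where
  "corrected_excess b u J K = excess b u J K + (\<Sum>d<b. defect b u J K d) / 2"

lemma shifted_reversal_less:
  assumes "0 < b" shows "shifted_reversal b d u X < b ^ u"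
proof (induction u arbitrary: X)
  case (Suc u)
  have "((X + d) mod b) + 1 \<le> b" using assms by (simp add: Suc_leI)
  then have "((X + d) mod b + 1) * b ^ u \<le> b * b ^ u" by (rule mult_le_mono1)
  then show ?case using Suc[of "X div b"] by (simp add: algebra_simps)
qed simp

text \<open>Appending a last digit \<open>c\<close> to \<open>X\<close> prepends the first digit \<open>c + d\<close> to the reversal, and
  two numbers are compared by their first digits, then, in case of a tie, by the rest.\<close>
lemma of_bool_reversal_Suc:
  assumes "0 < b" "c < b" "K < b ^ u"
  shows "(of_bool (shifted_reversal b d (Suc u) (b * X + c) < e * b ^ u + K) :: real) =
    of_bool ((c + d) mod b < e) + of_bool ((c + d) mod b = e) * of_bool (shifted_reversal b d u X < K)"
proof -
  have "(b * X + c + d) mod b = (c + d) mod b"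
    by (metis add.assoc mod_mult_self4 mult.commute)
  then show ?thesis
    using assms digit_less_iff[OF shifted_reversal_less[OF assms(1)] assms(3)] by auto
qed

text \<open>As \<open>d\<close> runs through all shifts, so does the first digit of the reversal. It is smaller than
  \<open>e\<close> for \<open>e\<close> of them, and the tie occurs for one shift only, namely
  \<open>e - c\<close> modulo \<open>b\<close>.\<close>
lemma sum_reversal_less_over_shifts:
  assumes "0 < b" "c < b" "e < b" "K < b ^ u"
  shows "(\<Sum>d<b. of_bool (shifted_reversal b d (Suc u) (b * X + c) < e * b ^ u + K)) =
    real e + of_bool (shifted_reversal b ((e + (b - c)) mod b) u X < K)"
proof -
  let ?s = "\<lambda>d. of_bool (shifted_reversal b d u X < K) :: real"
  have "(\<Sum>d<b. of_bool ((c + d) mod b < e)) = real e"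
    using sum_mod_shift[OF assms(1), of "\<lambda>y. of_bool (y < e) :: real" c] assms
    by (simp add: sum_of_bool_less add.commute del: sum_of_bool_eq)
  moreover have "(\<Sum>d<b. of_bool ((c + d) mod b = e) * ?s d) =
      (\<Sum>d<b. if d = (e + (b - c)) mod b then ?s d else 0)"
    by (rule sum.cong) (use assms in \<open>auto simp: add_mod_eq_iff\<close>)
  ultimately show ?thesis
    unfolding of_bool_reversal_Suc[OF assms(1,2,4)] using assms by (simp add: sum.distrib)
qed

text \<open>The same count for a fixed shift and variable last digit; here the tie leaves the shift, and hence the
  remaining comparison, unchanged.\<close>
lemma sum_reversal_less_over_last_digit:
  assumes "0 < b" "e < b" "K < b ^ u"
  shows "(\<Sum>c<b. of_bool (shifted_reversal b d (Suc u) (b * X + c) < e * b ^ u + K)) =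
    real e + of_bool (shifted_reversal b d u X < K)"
proof -
  have "(\<Sum>c<b. of_bool (shifted_reversal b d (Suc u) (b * X + c) < e * b ^ u + K)) =
    (\<Sum>c<b. of_bool ((c + d) mod b < e) + of_bool ((c + d) mod b = e) * (of_bool (shifted_reversal b d u X < K)::real))"
    by (rule sum.cong) (use assms of_bool_reversal_Suc in auto)
  also have "\<dots> = (\<Sum>c<b. of_bool (c < e) + of_bool (c = e) * of_bool (shifted_reversal b d u X < K))"
    by (rule sum_mod_shift[OF assms(1), of "\<lambda>c. of_bool (c < e) + of_bool (c = e) * (of_bool (shifted_reversal b d u X < K)::real)"])
  also have "(\<Sum>c<b. of_bool (c = e) * (of_bool (shifted_reversal b d u X < K)::real)) =
     (\<Sum>c<b. if c = e then of_bool (shifted_reversal b d u X < K) else 0)"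
    by (rule sum.cong) auto
  then have "(\<Sum>c<b. of_bool (c < e) + of_bool (c = e) * of_bool (shifted_reversal b d u X < K)) =
    real e + of_bool (shifted_reversal b d u X < K)"
    using assms by (simp add: sum.distrib sum_of_bool_less del: sum_of_bool_eq)
  finally show ?thesis .
qed

text \<open>The contraction: a sum of \<open>b\<close> defects turns into a single earlier defect, at a shift that is
  uniformly distributed when \<open>e\<close> is.\<close>
lemma sum_defect_Suc:
  assumes "0 < b" "j < b" "e < b" "K < b ^ u"
  shows "(\<Sum>d<b. defect b (Suc u) (b * J + j) (e * b ^ u + K) d) = defect b u J K ((e + (b - j)) mod b)"
  unfolding defect_def sum_subtractf sum_reversal_less_over_shifts[OF assms] using assms
  by (simp add: field_simps)

text \<open>The numbers below \<open>b * J + j\<close> are those with a prefix below \<open>J\<close> and any last digit, where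
  the count reproduces the previous excess, and those with prefix \<open>J\<close> and last digit below
  \<open>j\<close>, each of which contributes one defect.\<close>
lemma excess_Suc:
  assumes "0 < b" "j < b" "e < b" "K < b ^ u"
  shows "excess b (Suc u) (b * J + j) (e * b ^ u + K) =
    excess b u J K + (\<Sum>c<j. defect b u J K ((e + (b - c)) mod b))"
proof -
  let ?t = "\<lambda>d X. of_bool (shifted_reversal b d (Suc u) X < e * b ^ u + K) :: real"
  let ?s = "\<lambda>d X. of_bool (shifted_reversal b d u X < K) :: real"
  have split: "(\<Sum>X<b*J+j. F X) = (\<Sum>X<b*J. F X) + (\<Sum>c<j. F (b*J+c))" for F :: "nat \<Rightarrow> real"
    by (induction j) simp_all
  have "(\<Sum>d<b. \<Sum>X<b*J+j. ?t d X) = (\<Sum>d<b. \<Sum>X<J. \<Sum>c<b. ?t d (b * X + c)) + (\<Sum>d<b. \<Sum>c<j. ?t d (b*J+c))"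
    unfolding split sum_lessThan_mult by (simp add: sum.distrib)
  also have "(\<Sum>d<b. \<Sum>X<J. \<Sum>c<b. ?t d (b * X + c)) = (\<Sum>d<b. \<Sum>X<J. real e + ?s d X)"
    by (intro sum.cong refl sum_reversal_less_over_last_digit assms)
  also have "(\<Sum>d<b. \<Sum>c<j. ?t d (b*J+c)) = (\<Sum>c<j. \<Sum>d<b. ?t d (b*J+c))"
    by (rule sum.swap)
  also have "\<dots> = (\<Sum>c<j. real e + ?s ((e + (b - c)) mod b) J)"
    by (intro sum.cong refl sum_reversal_less_over_shifts) (use assms in auto)
  finally have *: "(\<Sum>d<b. \<Sum>X<b*J+j. ?t d X) =
     real b * real J * real e + (\<Sum>d<b. \<Sum>X<J. ?s d X) + real j * real e + (\<Sum>c<j. ?s ((e + (b - c)) mod b) J)"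
    by (simp add: sum.distrib)
  show ?thesis
    unfolding excess_def defect_def * sum_subtractf using assms by (simp add: field_simps)
qed

lemma defect_bounds:
  assumes "0 < b" "K < b ^ u" shows "\<bar>defect b u J K d\<bar> \<le> 1"
proof -
  have "real K < real b ^ u" using assms(2) by (metis of_nat_less_iff of_nat_power)
  then have "real K / real b ^ u \<le> 1" using assms by simp
  moreover have "0 \<le> real K / real b ^ u" by simp
  ultimately show ?thesis by (auto simp: defect_def of_bool_def)
qed

section \<open>The corrected excess is a martingale with bounded increments\<close>

text \<open>The change of the corrected excess in one step, as a function of the current defects \<open>g\<close> and of the
  new digits \<open>j\<close> and \<open>e\<close>.\<close>
definition increment :: "nat \<Rightarrow> (nat \<Rightarrow> real) \<Rightarrow> nat \<Rightarrow> nat \<Rightarrow> real" where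
  "increment b g j e = (\<Sum>c<j. g ((e + (b - c)) mod b)) + g ((e + (b - j)) mod b) / 2 - (\<Sum>d<b. g d) / 2"

lemma corrected_excess_Suc:
  assumes "0 < b" "j < b" "e < b" "K < b ^ u"
  shows "corrected_excess b (Suc u) (b * J + j) (e * b ^ u + K) =
    corrected_excess b u J K + increment b (defect b u J K) j e"
  unfolding corrected_excess_def excess_Suc[OF assms] sum_defect_Suc[OF assms] increment_def by simp

text \<open>The martingale property. The mean over \<open>e\<close> replaces every value of \<open>g\<close> by the mean of
  \<open>g\<close>, so with \<open>G\<close> the sum of \<open>g\<close> the sum over \<open>e\<close> is
  \<open>(j + 1/2 - b/2) * G\<close>, and this vanishes in mean over \<open>j\<close>.\<close>
lemma sum_increment:
  assumes "0 < b"
  shows "(\<Sum>j<b. \<Sum>e<b. increment b g j e) = 0"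
proof -
  have sh: "(\<Sum>e<b. g ((e + (b - c)) mod b)) = (\<Sum>d<b. g d)" for c
    by (rule sum_mod_shift[OF assms])
  have "(\<Sum>e<b. \<Sum>c<j. g ((e + (b - c)) mod b)) = real j * (\<Sum>d<b. g d)" for j
    by (subst sum.swap) (simp add: sh)
  then have "(\<Sum>e<b. increment b g j e) = (real j + 1/2 - real b / 2) * (\<Sum>d<b. g d)" for j
    by (simp add: increment_def sum.distrib sum_subtractf sh sum_divide_distrib[symmetric] algebra_simps)
  then have "(\<Sum>j<b. \<Sum>e<b. increment b g j e) = (\<Sum>j<b. real j + 1/2 - real b / 2) * (\<Sum>d<b. g d)"
    by (simp add: sum_distrib_right)
  moreover have "(\<Sum>j<n. real j + 1/2) = real n * real n / 2" for n
    by (induction n) (simp_all add: field_simps)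
  ultimately show ?thesis by (simp add: sum_subtractf)
qed

lemma abs_increment_le:
  assumes "j < b" "\<And>d. \<bar>g d\<bar> \<le> 1"
  shows "\<bar>increment b g j e\<bar> \<le> 2 * real b"
proof -
  have "\<bar>\<Sum>c<j. g ((e + (b - c)) mod b)\<bar> \<le> real j"
    using sum_norm_bound[of "{..<j}" "\<lambda>c. g ((e + (b - c)) mod b)" 1] assms(2) by simp
  moreover have "\<bar>\<Sum>d<b. g d\<bar> \<le> real b"
    using sum_norm_bound[of "{..<b}" g 1] assms(2) by simp
  moreover have "real j + 1 \<le> real b" using assms(1) by simp
  ultimately show ?thesis
    using assms(2)[of "(e + (b - j)) mod b"] unfolding increment_def by linarith
qed

section \<open>Exponential moments\<close>

lemma exp_le_quadratic:
  fixes x :: real assumes "\<bar>x\<bar> \<le> 1" shows "exp x \<le> 1 + x + x\<^sup>2"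
proof (cases "0 \<le> x")
  case True then show ?thesis using assms exp_bound[of x] by simp
next
  case False
  define y where "y = - x"
  have y: "0 \<le> y" using False by (simp add: y_def)
  have "(1 + y) * exp (- y) \<le> exp y * exp (- y)"
    by (intro mult_right_mono) (auto simp: exp_ge_add_one_self)
  also have "\<dots> \<le> 1 + y ^ 3" using y by (simp add: exp_minus_inverse)
  also have "\<dots> = (1 + y) * (1 - y + y\<^sup>2)" by (simp add: algebra_simps power3_eq_cube power2_eq_square)
  finally have "exp (- y) \<le> 1 - y + y\<^sup>2" using y by (simp add: mult_le_cancel_left_pos)
  then show ?thesis by (simp add: y_def)
qed

text \<open>In the quadratic bound for the exponential the linear term drops out, because the increments have mean
  zero.\<close>
lemma sum_exp_increment_le:
  assumes "0 < b" "\<And>d. \<bar>g d\<bar> \<le> 1" "\<bar>l\<bar> * (2 * real b) \<le> 1"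
  shows "(\<Sum>j<b. \<Sum>e<b. exp (l * increment b g j e)) \<le> (real b)\<^sup>2 * (1 + (l * (2 * real b))\<^sup>2)"
proof -
  have "exp (l * increment b g j e) \<le> 1 + l * increment b g j e + (l * (2 * real b))\<^sup>2" if "j < b" for j e
  proof -
    have *: "\<bar>l * increment b g j e\<bar> \<le> \<bar>l * (2 * real b)\<bar>"
      using abs_increment_le[of j b g e] that assms(2) by (simp add: abs_mult mult_left_mono)
    then have "(l * increment b g j e)\<^sup>2 \<le> (l * (2 * real b))\<^sup>2"
      using abs_le_square_iff by blast
    moreover have "\<bar>l * increment b g j e\<bar> \<le> 1"
      using * assms(3) by (simp add: abs_mult)
    ultimately show ?thesis
      using exp_le_quadratic[of "l * increment b g j e"] by linarith
  qed
  then have "(\<Sum>j<b. \<Sum>e<b. exp (l * increment b g j e)) \<le>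
      (\<Sum>j<b. \<Sum>e<b. 1 + l * increment b g j e + (l * (2 * real b))\<^sup>2)"
    by (intro sum_mono) auto
  also have "\<dots> = real b * real b + l * (\<Sum>j<b. \<Sum>e<b. increment b g j e) + real b * (real b * (l * (2 * real b))\<^sup>2)"
    by (simp add: sum.distrib sum_distrib_left)
  also have "\<dots> = (real b)\<^sup>2 * (1 + (l * (2 * real b))\<^sup>2)"
    unfolding sum_increment[OF assms(1)] by (simp add: power2_eq_square algebra_simps)
  finally show ?thesis .
qed

text \<open>The exponential moments multiply from step to step: given the digits already revealed, the factor
  contributed by the next pair of digits is bounded by a constant.\<close>
lemma sum_exp_corrected_excess_le:
  assumes "0 < b" "\<bar>l\<bar> * (2 * real b) \<le> 1"
  shows "(\<Sum>J<b^u. \<Sum>K<b^u. exp (l * corrected_excess b u J K))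
    \<le> ((real b)\<^sup>2 * (1 + (l * (2 * real b))\<^sup>2)) ^ u"
proof (induction u)
  case 0
  show ?case by (simp add: corrected_excess_def excess_def defect_def)
next
  case (Suc u)
  let ?S = "corrected_excess b u" and ?h = "\<lambda>J K. increment b (defect b u J K)"
  let ?c = "(real b)\<^sup>2 * (1 + (l * (2 * real b))\<^sup>2)"
  have "(\<Sum>J<b^Suc u. \<Sum>K<b^Suc u. exp (l * corrected_excess b (Suc u) J K)) =
    (\<Sum>J<b^u. \<Sum>j<b. \<Sum>e<b. \<Sum>K<b^u. exp (l * corrected_excess b (Suc u) (b * J + j) (e * b ^ u + K)))"
    by (rule sum_grid_Suc)
  also have "\<dots> = (\<Sum>J<b^u. \<Sum>j<b. \<Sum>e<b. \<Sum>K<b^u. exp (l * ?S J K) * exp (l * ?h J K j e))"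
    by (intro sum.cong refl) (use assms in \<open>auto simp: corrected_excess_Suc distrib_left exp_add\<close>)
  also have "\<dots> = (\<Sum>J<b^u. \<Sum>K<b^u. exp (l * ?S J K) * (\<Sum>j<b. \<Sum>e<b. exp (l * ?h J K j e)))"
    by (simp add: sum_distrib_left sum.swap[of _ "{..<b^u}" "{..<b}"])
  also have "\<dots> \<le> (\<Sum>J<b^u. \<Sum>K<b^u. exp (l * ?S J K) * ?c)"
    by (intro sum_mono mult_left_mono sum_exp_increment_le assms defect_bounds) auto
  also have "\<dots> = (\<Sum>J<b^u. \<Sum>K<b^u. exp (l * ?S J K)) * ?c"
    by (simp add: sum_distrib_right)
  also have "\<dots> \<le> ?c ^ u * ?c"
    by (intro mult_right_mono Suc) auto
  finally show ?case by (simp add: mult.commute)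
qed

text \<open>With \<open>l = 1 / (2 * b * sqrt m)\<close> the factor per step is \<open>1 + 1 / m\<close>, apart from the
  \<open>b\<^sup>2\<close> choices of the new digits, so that \<open>m\<close> steps contribute at most \<open>exp 1\<close>. The sign
  \<open>\<sigma>\<close> provides both tails.\<close>
lemma sum_exp_normalized_le:
  assumes "0 < b" "0 < m" "\<bar>\<sigma>\<bar> = 1"
  shows "(\<Sum>J<b^m. \<Sum>K<b^m. exp (\<sigma> * (corrected_excess b m J K / (2 * real b * sqrt (real m)))))
    \<le> (real b ^ m)\<^sup>2 * exp 1"
proof -
  define l where "l = \<sigma> / (2 * real b * sqrt (real m))"
  have "1 \<le> sqrt (real m)" using assms by simp
  then have "\<bar>l\<bar> * (2 * real b) \<le> 1" using assms by (simp add: l_def abs_mult field_simps)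
  have "\<sigma>\<^sup>2 = 1" using assms(3) by (metis power2_abs power_one)
  then have "(l * (2 * real b))\<^sup>2 = 1 / real m"
    using assms by (simp add: l_def power_divide power_mult_distrib)
  then have "((real b)\<^sup>2 * (1 + (l * (2 * real b))\<^sup>2)) ^ m = (real b ^ m)\<^sup>2 * (1 + 1 / real m) ^ m"
    by (simp add: power_mult_distrib power_even_eq power_mult[symmetric] mult.commute)
  also have "\<dots> \<le> (real b ^ m)\<^sup>2 * exp 1"
    using exp_ge_one_plus_x_over_n_power_n[of m 1] assms by (intro mult_left_mono) auto
  finally show ?thesis
    using sum_exp_corrected_excess_le[OF assms(1) \<open>\<bar>l\<bar> * (2 * real b) \<le> 1\<close>, of m]
    by (simp add: l_def)
qed

lemma abs_excess_le:
  assumes "0 < b" "K < b ^ u"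
  shows "\<bar>excess b u J K\<bar> \<le> \<bar>corrected_excess b u J K\<bar> + real b / 2"
proof -
  have "\<bar>\<Sum>d<b. defect b u J K d\<bar> \<le> real b"
    using sum_norm_bound[of "{..<b}" "defect b u J K" 1] defect_bounds[OF assms] by simp
  then show ?thesis unfolding corrected_excess_def by linarith
qed

section \<open>The point set in integer coordinates\<close>

definition x_index :: "nat \<Rightarrow> nat \<Rightarrow> nat \<Rightarrow> (nat \<Rightarrow> nat) \<Rightarrow> nat" where
  "x_index b u r a = (\<Sum>i=1..u. digit_add b (a i) r * b ^ (u - i))"

definition y_index :: "nat \<Rightarrow> nat \<Rightarrow> nat \<Rightarrow> (nat \<Rightarrow> nat) \<Rightarrow> nat" where
  "y_index b u s a = (\<Sum>i=1..u. digit_add b (a i) s * b ^ (i - 1))"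

lemma x_index_Suc: "x_index b (Suc u) r a = b * x_index b u r a + digit_add b (a (Suc u)) r"
proof -
  have "(\<Sum>i=1..u. digit_add b (a i) r * b ^ (Suc u - i)) = b * x_index b u r a"
    unfolding x_index_def sum_distrib_left
    by (rule sum.cong) (auto simp: Suc_diff_le)
  then show ?thesis by (simp add: x_index_def)
qed

lemma y_index_Suc: "y_index b (Suc u) s a = digit_add b (a (Suc u)) s * b ^ u + y_index b u s a"
  by (simp add: y_index_def)

lemma y_index_eq_shifted_reversal:
  assumes "0 < b" "(r + d) mod b = s mod b"
  shows "y_index b u s a = shifted_reversal b d u (x_index b u r a)"
proof (induction u)
  case 0 show ?case by (simp add: y_index_def)
next
  case (Suc u)
  have "(b * x_index b u r a + digit_add b (a (Suc u)) r + d) mod b = (a (Suc u) + (r + d)) mod b"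
    by (simp add: digit_add_def mod_simps add.assoc)
  also have "\<dots> = digit_add b (a (Suc u)) s"
    unfolding digit_add_def by (metis assms(2) mod_add_right_eq)
  finally show ?case using assms(1)
    by (simp add: x_index_Suc y_index_Suc Suc digit_add_def)
qed

lemma sum_PiE_insert:
  fixes F :: "('a \<Rightarrow> 'b) \<Rightarrow> 'c::comm_monoid_add"
  assumes "x \<notin> S"
  shows "(\<Sum>f\<in>PiE (insert x S) T. F f) = (\<Sum>g\<in>PiE S T. \<Sum>y\<in>T x. F (g(x := y)))"
proof -
  have "(\<Sum>f\<in>PiE (insert x S) T. F f) = (\<Sum>(y, g)\<in>T x \<times> PiE S T. F (g(x := y)))"
    unfolding PiE_insert_eq by (subst sum.reindex[OF inj_combinator[OF assms]]) (simp add: case_prod_unfold)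
  also have "\<dots> = (\<Sum>g\<in>PiE S T. \<Sum>y\<in>T x. F (g(x := y)))"
    by (simp add: sum.cartesian_product[symmetric] sum.swap[of _ "PiE S T"])
  finally show ?thesis .
qed

lemma sum_PiE_Suc:
  fixes F :: "(nat \<Rightarrow> nat) \<Rightarrow> 'c::comm_monoid_add"
  shows "(\<Sum>a\<in>{1..Suc n} \<rightarrow>\<^sub>E {0..<b}. F a) = (\<Sum>a\<in>{1..n} \<rightarrow>\<^sub>E {0..<b}. \<Sum>y<b. F (a(Suc n := y)))"
proof -
  have "{1..Suc n} = insert (Suc n) {1..n}" by auto
  then show ?thesis by (simp add: sum_PiE_insert lessThan_atLeast0)
qed

lemma x_index_cong: "(\<And>i. i \<in> {1..u} \<Longrightarrow> a i = a' i) \<Longrightarrow> x_index b u r a = x_index b u r a'"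
  by (simp add: x_index_def)

lemma y_index_cong: "(\<And>i. i \<in> {1..u} \<Longrightarrow> a i = a' i) \<Longrightarrow> y_index b u r a = y_index b u r a'"
  by (simp add: y_index_def)

text \<open>For a fixed shift \<open>r\<close> of the digits every integer below \<open>b ^ u\<close> occurs exactly once.\<close>
lemma sum_x_index:
  fixes F :: "nat \<Rightarrow> real"
  assumes "0 < b"
  shows "(\<Sum>a\<in>{1..u} \<rightarrow>\<^sub>E {0..<b}. F (x_index b u r a)) = (\<Sum>X<b^u. F X)"
proof (induction u arbitrary: F)
  case 0 show ?case by (simp add: x_index_def)
next
  case (Suc u)
  have "x_index b u r (a(Suc u := y)) = x_index b u r a" for a y
    by (rule x_index_cong) auto
  then have "(\<Sum>a\<in>{1..Suc u} \<rightarrow>\<^sub>E {0..<b}. F (x_index b (Suc u) r a)) =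
    (\<Sum>a\<in>{1..u} \<rightarrow>\<^sub>E {0..<b}. \<Sum>y<b. F (b * x_index b u r a + (y + r) mod b))"
    unfolding sum_PiE_Suc by (simp add: x_index_Suc digit_add_def)
  also have "\<dots> = (\<Sum>a\<in>{1..u} \<rightarrow>\<^sub>E {0..<b}. \<Sum>c<b. F (b * x_index b u r a + c))"
    by (rule sum.cong[OF refl], rule sum_mod_shift[OF assms])
  also have "\<dots> = (\<Sum>X<b^u. \<Sum>c<b. F (b * X + c))" by (rule Suc)
  also have "\<dots> = (\<Sum>X<b^Suc u. F X)" by (simp add: sum_lessThan_mult)
  finally show ?case .
qed

text \<open>The shifted reversal permutes the integers below \<open>b ^ u\<close>. Stating it as invariance of sums
  lets the induction follow the digits directly.\<close>
lemma sum_shifted_reversal: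
  fixes F :: "nat \<Rightarrow> real"
  assumes "0 < b"
  shows "(\<Sum>X<b^u. F (shifted_reversal b d u X)) = (\<Sum>Y<b^u. F Y)"
proof (induction u arbitrary: F)
  case 0 show ?case by simp
next
  case (Suc u)
  have m: "(b * X + c + d) mod b = (c + d) mod b" for X c
    by (metis add.assoc mod_mult_self4 mult.commute)
  have "(\<Sum>X<b^Suc u. F (shifted_reversal b d (Suc u) X)) =
    (\<Sum>X<b^u. \<Sum>c<b. F ((c + d) mod b * b ^ u + shifted_reversal b d u X))"
    using assms by (simp add: sum_lessThan_mult m)
  also have "\<dots> = (\<Sum>X<b^u. \<Sum>c<b. F (c * b ^ u + shifted_reversal b d u X))"
    by (rule sum.cong[OF refl], rule sum_mod_shift[OF assms])
  also have "\<dots> = (\<Sum>c<b. \<Sum>X<b^u. F (c * b ^ u + shifted_reversal b d u X))" by (rule sum.swap)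
  also have "\<dots> = (\<Sum>c<b. \<Sum>Y<b^u. F (c * b ^ u + Y))"
    by (rule sum.cong[OF refl], rule Suc)
  also have "\<dots> = (\<Sum>Y<b^Suc u. F Y)"
    using sum_lessThan_mult[of F "b ^ u" b] by (simp add: mult.commute)
  finally show ?case .
qed

text \<open>The second coordinate depends on the two shift digits \<open>r\<close> and \<open>s\<close> only through the first
  coordinate and \<open>s - r\<close>, which takes every value \<open>b\<close> times.\<close>
lemma sum_sym_hammersley_indices:
  fixes F :: "nat \<Rightarrow> nat \<Rightarrow> real"
  assumes "0 < b"
  shows "(\<Sum>a\<in>{1..m+2} \<rightarrow>\<^sub>E {0..<b}. F (x_index b m (a (m+1)) a) (y_index b m (a (m+2)) a)) =
    real b * (\<Sum>d<b. \<Sum>X<b^m. F X (shifted_reversal b d m X))"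
proof -
  have x: "x_index b m v (a(Suc m := r, Suc (Suc m) := s)) = x_index b m v a" for a r s v
    by (rule x_index_cong) auto
  have y: "y_index b m v (a(Suc m := r, Suc (Suc m) := s)) = y_index b m v a" for a r s v
    by (rule y_index_cong) auto
  let ?A = "{1..m} \<rightarrow>\<^sub>E {0..<b}"
  have "(\<Sum>a\<in>{1..m+2} \<rightarrow>\<^sub>E {0..<b}. F (x_index b m (a (m+1)) a) (y_index b m (a (m+2)) a)) =
     (\<Sum>a\<in>?A. \<Sum>r<b. \<Sum>s<b. F (x_index b m r a) (y_index b m s a))"
    unfolding add_2_eq_Suc' sum_PiE_Suc by (simp add: x y)
  also have "\<dots> = (\<Sum>a\<in>?A. \<Sum>r<b. \<Sum>d<b. F (x_index b m r a) (y_index b m ((d + r) mod b) a))"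
    by (intro sum.cong refl sum_mod_shift[OF assms, symmetric])
  also have "\<dots> = (\<Sum>a\<in>?A. \<Sum>r<b. \<Sum>d<b. F (x_index b m r a) (shifted_reversal b d m (x_index b m r a)))"
    by (intro sum.cong refl arg_cong2[of _ _ _ _ F] y_index_eq_shifted_reversal) (simp_all add: assms add.commute)
  also have "\<dots> = (\<Sum>r<b. \<Sum>d<b. \<Sum>a\<in>?A. F (x_index b m r a) (shifted_reversal b d m (x_index b m r a)))"
    by (simp only: sum.swap[of _ ?A "{..<b}"])
  also have "\<dots> = (\<Sum>r<b. \<Sum>d<b. \<Sum>X<b^m. F X (shifted_reversal b d m X))"
    by (intro sum.cong refl sum_x_index assms)
  finally show ?thesis by simp
qed

text \<open>The repeated last digit adds at most one grid width. The upper bound is attained for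
  \<open>r = b - 1\<close>, so a point may lie on the far edge of its grid cell.\<close>
lemma digit_tail_bounds:
  assumes "2 \<le> b" "r < b"
  shows "0 \<le> (\<Sum>k. real r / real b ^ (m + 1 + k))" "(\<Sum>k. real r / real b ^ (m + 1 + k)) \<le> 1 / real b ^ m"
proof -
  have eq: "(\<lambda>k. real r / real b ^ (m + 1 + k)) = (\<lambda>k. real r / real b ^ (m + 1) * (1 / real b) ^ k)"
    by (simp add: power_add power_divide mult.assoc)
  have "(\<Sum>k. real r / real b ^ (m + 1 + k)) = real r / real b ^ (m + 1) * (1 / (1 - 1 / real b))"
    unfolding eq using assms by (subst suminf_mult) (auto simp: suminf_geometric intro!: summable_geometric)
  also have "\<dots> = real r / (real b - 1) * (1 / real b ^ m)"
    using assms by (simp add: field_simps)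
  finally have *: "(\<Sum>k. real r / real b ^ (m + 1 + k)) = real r / (real b - 1) * (1 / real b ^ m)" .
  have "real r / (real b - 1) \<le> 1" "0 \<le> real r / (real b - 1)" using assms by (auto simp: divide_le_eq_1)
  then show "0 \<le> (\<Sum>k. real r / real b ^ (m + 1 + k))" "(\<Sum>k. real r / real b ^ (m + 1 + k)) \<le> 1 / real b ^ m"
    unfolding * using mult_right_mono[of "real r / (real b - 1)" 1 "1 / real b ^ m"]
    by (auto simp del: times_divide_eq_left times_divide_eq_right times_divide_times_eq)
qed

lemma hammersley_x_bounds:
  assumes "2 \<le> b" "a (m + 1) < b"
  shows "real (x_index b m (a (m+1)) a) / real b ^ m \<le> hammersley_x b m a"
    "hammersley_x b m a \<le> real (x_index b m (a (m+1)) a + 1) / real b ^ m"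
proof -
  have "(\<Sum>i=1..m. real (digit_add b (a i) (a (m+1))) / real b ^ i) = real (x_index b m (a (m+1)) a) / real b ^ m"
    unfolding x_index_def of_nat_sum sum_divide_distrib
  proof (rule sum.cong)
    fix i assume i: "i \<in> {1..m}"
    have "real b ^ m = real b ^ i * real b ^ (m - i)"
      using i by (simp add: power_add[symmetric])
    then show "real (digit_add b (a i) (a (m+1))) / real b ^ i =
        real (digit_add b (a i) (a (m + 1)) * b ^ (m - i)) / real b ^ m"
      using assms by simp
  qed simp
  then show "real (x_index b m (a (m+1)) a) / real b ^ m \<le> hammersley_x b m a"
    "hammersley_x b m a \<le> real (x_index b m (a (m+1)) a + 1) / real b ^ m"
    using digit_tail_bounds[OF assms, of m] by (simp_all add: hammersley_x_def add_divide_distrib)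
qed

lemma hammersley_y_bounds:
  assumes "2 \<le> b" "a (m + 2) < b"
  shows "real (y_index b m (a (m+2)) a) / real b ^ m \<le> hammersley_y b m a"
    "hammersley_y b m a \<le> real (y_index b m (a (m+2)) a + 1) / real b ^ m"
proof -
  have "(\<Sum>i=1..m. real (digit_add b (a (m+1-i)) (a (m+2))) / real b ^ i) =
      (\<Sum>i=1..m. real (digit_add b (a i) (a (m+2))) / real b ^ (m + 1 - i))"
    by (subst sum.atLeastAtMost_rev) (rule sum.cong, auto)
  also have "\<dots> = real (y_index b m (a (m+2)) a) / real b ^ m"
    unfolding y_index_def of_nat_sum sum_divide_distrib
  proof (rule sum.cong)
    fix i assume i: "i \<in> {1..m}"
    have "real b ^ m = real b ^ (m + 1 - i) * real b ^ (i - 1)"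
      using i by (simp add: power_add[symmetric])
    then show "real (digit_add b (a i) (a (m+2))) / real b ^ (m + 1 - i) =
        real (digit_add b (a i) (a (m + 2)) * b ^ (i - 1)) / real b ^ m"
      using assms by simp
  qed simp
  finally show "real (y_index b m (a (m+2)) a) / real b ^ m \<le> hammersley_y b m a"
    "hammersley_y b m a \<le> real (y_index b m (a (m+2)) a + 1) / real b ^ m"
    using digit_tail_bounds[OF assms, of m] by (simp_all add: hammersley_y_def add_divide_distrib)
qed

lemma size_sym_hammersley: "size (sym_hammersley b m) = b ^ (m + 2)"
  by (simp add: sym_hammersley_def card_PiE)

section \<open>Rounding to the grid\<close>

text \<open>Both \<open>x\<close> and \<open>t\<close> are known up to one grid width only, from the closed cells that contain
  them. Hence the comparison can fail for the cell of \<open>t\<close> itself, and for the cell before it, whose right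
  edge \<open>x\<close> may reach.\<close>
lemma less_iff_index_less:
  assumes "0 < q" "real X / q \<le> x" "x \<le> real (X + 1) / q" "real j / q \<le> t" "t \<le> real (j + 1) / q"
    "X \<noteq> j" "X + 1 \<noteq> j"
  shows "x < t \<longleftrightarrow> X < j"
proof
  assume "x < t"
  then have "real X / q < real (j + 1) / q" using assms by linarith
  then show "X < j" using assms by (simp add: divide_less_cancel)
next
  assume "X < j"
  then have "real (X + 1) < real j" using assms by linarith
  then have "real (X + 1) / q < real j / q" using assms(1) by (rule divide_strict_right_mono)
  then show "x < t" using assms by linarith
qed

lemma sum_point_index_le:
  fixes F :: "nat \<Rightarrow> real"
  assumes "0 < b" "(\<Sum>X<b^m. F X) \<le> 1"
  shows "(\<Sum>a\<in>{1..m+2} \<rightarrow>\<^sub>E {0..<b}. F (x_index b m (a (m+1)) a)) \<le> (real b)\<^sup>2"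
    and "(\<Sum>a\<in>{1..m+2} \<rightarrow>\<^sub>E {0..<b}. F (y_index b m (a (m+2)) a)) \<le> (real b)\<^sup>2"
proof -
  have "real b * (\<Sum>d<b. \<Sum>X<b^m. F X) \<le> real b * (\<Sum>d<b. 1)"
    by (intro mult_left_mono sum_mono assms) simp
  then have *: "real b * (\<Sum>d<b. \<Sum>X<b^m. F X) \<le> (real b)\<^sup>2"
    by (simp add: power2_eq_square)
  show "(\<Sum>a\<in>{1..m+2} \<rightarrow>\<^sub>E {0..<b}. F (x_index b m (a (m+1)) a)) \<le> (real b)\<^sup>2"
    unfolding sum_sym_hammersley_indices[OF assms(1), where m = m and F = "\<lambda>X Y. F X"] by (rule *)
  show "(\<Sum>a\<in>{1..m+2} \<rightarrow>\<^sub>E {0..<b}. F (y_index b m (a (m+2)) a)) \<le> (real b)\<^sup>2"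
    unfolding sum_sym_hammersley_indices[OF assms(1), where m = m and F = "\<lambda>X Y. F Y"] sum_shifted_reversal[OF assms(1)] by (rule *)
qed

lemma sum_of_bool_le_1:
  assumes "finite A" "\<And>x y. x \<in> A \<Longrightarrow> y \<in> A \<Longrightarrow> P x \<Longrightarrow> P y \<Longrightarrow> x = y"
  shows "(\<Sum>x\<in>A. of_bool (P x)) \<le> (1 :: real)"
proof -
  have "card (A \<inter> {x. P x}) \<le> 1"
    using assms by (subst One_nat_def, subst card_le_Suc0_iff_eq) auto
  then show ?thesis using assms(1) by simp
qed

text \<open>A grid column or row contains \<open>b\<^sup>2\<close> points; columns and rows beyond the grid contain
  none.\<close>
lemma sum_near_index_le:
  assumes "0 < b"
  shows "(\<Sum>a\<in>{1..m+2} \<rightarrow>\<^sub>E {0..<b}. of_bool (x_index b m (a (m+1)) a = n)) \<le> (real b)\<^sup>2"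
    and "(\<Sum>a\<in>{1..m+2} \<rightarrow>\<^sub>E {0..<b}. of_bool (x_index b m (a (m+1)) a + 1 = n)) \<le> (real b)\<^sup>2"
    and "(\<Sum>a\<in>{1..m+2} \<rightarrow>\<^sub>E {0..<b}. of_bool (y_index b m (a (m+2)) a = n)) \<le> (real b)\<^sup>2"
    and "(\<Sum>a\<in>{1..m+2} \<rightarrow>\<^sub>E {0..<b}. of_bool (y_index b m (a (m+2)) a + 1 = n)) \<le> (real b)\<^sup>2"
proof -
  have 1: "(\<Sum>X<b^m. of_bool (X = n)) \<le> (1 :: real)" by (rule sum_of_bool_le_1) auto
  have 2: "(\<Sum>X<b^m. of_bool (X + 1 = n)) \<le> (1 :: real)" by (rule sum_of_bool_le_1) auto
  note le1 = sum_point_index_le[OF assms 1] and le2 = sum_point_index_le[OF assms 2]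
  show "(\<Sum>a\<in>{1..m+2} \<rightarrow>\<^sub>E {0..<b}. of_bool (x_index b m (a (m+1)) a = n)) \<le> (real b)\<^sup>2"
    by (rule le1(1))
  show "(\<Sum>a\<in>{1..m+2} \<rightarrow>\<^sub>E {0..<b}. of_bool (x_index b m (a (m+1)) a + 1 = n)) \<le> (real b)\<^sup>2"
    by (rule le2(1))
  show "(\<Sum>a\<in>{1..m+2} \<rightarrow>\<^sub>E {0..<b}. of_bool (y_index b m (a (m+2)) a = n)) \<le> (real b)\<^sup>2"
    by (rule le1(2))
  show "(\<Sum>a\<in>{1..m+2} \<rightarrow>\<^sub>E {0..<b}. of_bool (y_index b m (a (m+2)) a + 1 = n)) \<le> (real b)\<^sup>2"
    by (rule le2(2))
qed

text \<open>The factor \<open>b\<close> is the multiplicity with which each shift \<open>d\<close> occurs.\<close>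
lemma sum_index_less_eq_excess:
  assumes "0 < b" "j \<le> b ^ m"
  shows "(\<Sum>a\<in>{1..m+2} \<rightarrow>\<^sub>E {0..<b}. of_bool (x_index b m (a (m+1)) a < j \<and> y_index b m (a (m+2)) a < k)) =
    real b * (excess b m j k + real b * real j * real k / real b ^ m)"
proof -
  have "(\<Sum>X<b^m. of_bool (X < j \<and> P X)) = (\<Sum>X<j. of_bool (P X) :: real)" for P
  proof -
    have "{..<b^m} \<inter> {X. X < j \<and> P X} = {..<j} \<inter> {X. P X}" using assms(2) by auto
    then show ?thesis by simp
  qed
  then show ?thesis
    unfolding sum_sym_hammersley_indices[OF assms(1), where m = m and F = "\<lambda>X Y. of_bool (X < j \<and> Y < k)"] excess_def by simp
qed

lemma mult_local_disc_eq:
  assumes "2 \<le> b"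
  shows "real b ^ (m + 2) * local_disc (sym_hammersley b m) (t1, t2) =
    (\<Sum>a\<in>{1..m+2} \<rightarrow>\<^sub>E {0..<b}. of_bool (hammersley_x b m a < t1 \<and> hammersley_y b m a < t2))
      - real b ^ (m + 2) * (t1 * t2)"
proof -
  let ?A = "{1..m+2} \<rightarrow>\<^sub>E {0..<b}"
  have "(\<Sum>x\<in>#sym_hammersley b m. indicator ({0..<t1} \<times> {0..<t2}) x) =
     (\<Sum>a\<in>?A. indicator ({0..<t1} \<times> {0..<t2}) (hammersley_x b m a, hammersley_y b m a) :: real)"
    by (simp add: sym_hammersley_def sum_unfold_sum_mset image_mset.compositionality o_def)
  also have "\<dots> = (\<Sum>a\<in>?A. of_bool (hammersley_x b m a < t1 \<and> hammersley_y b m a < t2))"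
  proof (rule sum.cong[OF refl])
    fix a assume "a \<in> ?A"
    then have a: "a (m+1) < b" "a (m+2) < b" by (auto simp: PiE_iff)
    have "0 \<le> hammersley_x b m a" "0 \<le> hammersley_y b m a"
      using hammersley_x_bounds(1)[of b a m] hammersley_y_bounds(1)[of b a m] a assms
      by (meson divide_nonneg_nonneg of_nat_0_le_iff order_trans zero_le_power)+
    then show "indicator ({0..<t1} \<times> {0..<t2}) (hammersley_x b m a, hammersley_y b m a) =
        (of_bool (hammersley_x b m a < t1 \<and> hammersley_y b m a < t2) :: real)"
      by (simp add: indicator_def)
  qed
  finally show ?thesis
    using assms by (simp add: local_disc_def size_sym_hammersley right_diff_distrib)
qed

text \<open>Moving the corner of the test box within a grid cell affects only points in its own and the preceding
  column and row, which are \<open>4 * b\<^sup>2\<close> points at most, and it changes the expected number of points by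
  at most \<open>2 * b\<^sup>2\<close>.\<close>
lemma abs_local_disc_le_on_box:
  assumes b: "2 \<le> b" and jk: "j < b ^ m" "k < b ^ m"
    and t: "t \<in> {real j / real b ^ m..real (j + 1) / real b ^ m} \<times> {real k / real b ^ m..real (k + 1) / real b ^ m}"
  shows "real b ^ (m + 2) * \<bar>local_disc (sym_hammersley b m) t\<bar> \<le> real b * \<bar>excess b m j k\<bar> + 6 * (real b)\<^sup>2"
proof -
  obtain t1 t2 where tt: "t = (t1, t2)" by (cases t)
  let ?q = "real b ^ m"
  have q: "0 < ?q" using b by simp
  have t1: "real j / ?q \<le> t1" "t1 \<le> real (j + 1) / ?q" and t2: "real k / ?q \<le> t2" "t2 \<le> real (k + 1) / ?q"
    using t by (auto simp: tt)
  let ?A = "{1..m+2} \<rightarrow>\<^sub>E {0..<b}"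
  let ?X = "\<lambda>a. x_index b m (a (m+1)) a" and ?Y = "\<lambda>a. y_index b m (a (m+2)) a"
  let ?f = "\<lambda>a. of_bool (hammersley_x b m a < t1 \<and> hammersley_y b m a < t2) :: real"
  let ?g = "\<lambda>a. of_bool (?X a < j \<and> ?Y a < k) :: real"
  have "\<bar>sum ?f ?A - sum ?g ?A\<bar> \<le> (\<Sum>a\<in>?A. \<bar>?f a - ?g a\<bar>)"
    unfolding sum_subtractf[symmetric] by (rule sum_abs)
  also have "\<dots> \<le> (\<Sum>a\<in>?A. of_bool (?X a = j) + of_bool (?X a + 1 = j) + of_bool (?Y a = k) + of_bool (?Y a + 1 = k))"
  proof (rule sum_mono)
    fix a assume "a \<in> ?A"
    then have a: "a (m+1) < b" "a (m+2) < b" by (auto simp: PiE_iff)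
    show "\<bar>?f a - ?g a\<bar> \<le> of_bool (?X a = j) + of_bool (?X a + 1 = j) + of_bool (?Y a = k) + of_bool (?Y a + 1 = k)"
    proof (cases "?X a = j \<or> ?X a + 1 = j \<or> ?Y a = k \<or> ?Y a + 1 = k")
      case True
      then have "1 \<le> of_bool (?X a = j) + of_bool (?X a + 1 = j) + of_bool (?Y a = k) + (of_bool (?Y a + 1 = k) :: real)"
        by auto
      moreover have "\<bar>?f a - ?g a\<bar> \<le> 1" by simp
      ultimately show ?thesis by linarith
    next
      case False
      have "hammersley_x b m a < t1 \<longleftrightarrow> ?X a < j"
        by (rule less_iff_index_less[OF q hammersley_x_bounds[where a = a and m = m, OF b a(1)] t1]) (use False in auto)
      moreover have "hammersley_y b m a < t2 \<longleftrightarrow> ?Y a < k"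
        by (rule less_iff_index_less[OF q hammersley_y_bounds[where a = a and m = m, OF b a(2)] t2]) (use False in auto)
      ultimately show ?thesis by simp
    qed
  qed
  also have "\<dots> \<le> 4 * (real b)\<^sup>2"
    using sum_near_index_le[of b m j] sum_near_index_le[of b m k] b
    unfolding sum.distrib by linarith
  finally have count: "\<bar>sum ?f ?A - sum ?g ?A\<bar> \<le> 4 * (real b)\<^sup>2" .
  define v w where "v = ?q * t1" and "w = ?q * t2"
  have v: "real j \<le> v" "v \<le> real j + 1" and w: "real k \<le> w" "w \<le> real k + 1"
    using t1 t2 q by (auto simp: v_def w_def field_simps)
  have "real j * real k \<le> v * w" using v w by (intro mult_mono) auto
  moreover have "v * w \<le> (real j + 1) * (real k + 1)" using v w by (intro mult_mono) auto
  moreover have "real j + 1 \<le> ?q" "real k + 1 \<le> ?q"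
    using jk by (metis Suc_eq_plus1 Suc_leI of_nat_1 of_nat_add of_nat_le_iff of_nat_power)+
  ultimately have "\<bar>v * w - real j * real k\<bar> \<le> 2 * ?q"
    by (simp add: algebra_simps abs_le_iff)
  then have "(real b)\<^sup>2 / ?q * \<bar>v * w - real j * real k\<bar> \<le> (real b)\<^sup>2 / ?q * (2 * ?q)"
    by (intro mult_left_mono) auto
  then have "\<bar>(real b)\<^sup>2 / ?q * (v * w - real j * real k)\<bar> \<le> 2 * (real b)\<^sup>2"
    using q by (simp add: abs_mult mult.commute split: if_splits)
  also have "(real b)\<^sup>2 / ?q * (v * w - real j * real k) =
      real b ^ (m + 2) * (t1 * t2) - real b * (real b * real j * real k / ?q)"
    using q by (simp add: v_def w_def power_add power2_eq_square field_simps)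
  finally have area: "\<bar>real b ^ (m + 2) * (t1 * t2) - real b * (real b * real j * real k / ?q)\<bar> \<le> 2 * (real b)\<^sup>2" .
  have "sum ?g ?A = real b * excess b m j k + real b * (real b * real j * real k / ?q)"
    unfolding distrib_left[symmetric]
    by (rule sum_index_less_eq_excess) (use b jk in auto)
  with count area have "\<bar>sum ?f ?A - real b ^ (m + 2) * (t1 * t2)\<bar> \<le> \<bar>real b * excess b m j k\<bar> + 6 * (real b)\<^sup>2"
    by linarith
  then have "\<bar>real b ^ (m + 2) * local_disc (sym_hammersley b m) (t1, t2)\<bar> \<le> \<bar>real b * excess b m j k\<bar> + 6 * (real b)\<^sup>2"
    unfolding mult_local_disc_eq[OF b] .
  then show ?thesis by (simp add: tt abs_mult)
qed

section \<open>From exponential moments to the discrepancy\<close>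

lemma grid_interval_exists:
  assumes "0 < q" "0 \<le> x" "x \<le> (1::real)"
  shows "\<exists>j<q. real j / real q \<le> x \<and> x \<le> real (j + 1) / real q"
proof (cases "x = 1")
  case True
  then show ?thesis using assms by (intro exI[of _ "q - 1"]) (auto simp: of_nat_diff)
next
  case False
  define j where "j = nat \<lfloor>real q * x\<rfloor>"
  have "0 \<le> real q * x" "real q * x < real q" using assms False by auto
  then have "real j \<le> real q * x" "real q * x < real j + 1" "j < q"
    by (auto simp: j_def) (simp_all add: floor_less_iff nat_less_iff)
  then show ?thesis using assms by (intro exI[of _ j]) (auto simp: field_simps)
qed

text \<open>Closed cells cover the whole unit square, and for an upper bound of the integral of a function with nonnegative
  majorants their overlaps do no harm.\<close>
lemma unit_square_integral_le_grid_average: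
  fixes f :: "real \<times> real \<Rightarrow> real"
  assumes q: "0 < q" and f: "set_integrable lborel ({0..1} \<times> {0..1}) f"
    and w: "\<And>j k. 0 \<le> w j k"
    and le: "\<And>j k t. \<lbrakk>j < q; k < q;
        t \<in> {real j / real q..real (j + 1) / real q} \<times> {real k / real q..real (k + 1) / real q}\<rbrakk> \<Longrightarrow> f t \<le> w j k"
  shows "(LINT t:{0..1} \<times> {0..1}|lborel. f t) \<le> (\<Sum>j<q. \<Sum>k<q. w j k) / (real q)\<^sup>2"
proof -
  define I where "I j = {real j / real q..real (j + 1) / real q}" for j
  define B where "B = {..<q} \<times> {..<q}"
  have measure_box: "emeasure lborel (I j \<times> I k) = ennreal (1 / (real q)\<^sup>2)" for j k
  proof -
    have "emeasure lborel (I j \<times> I k) = emeasure lborel (I j) * emeasure lborel (I k)"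
      unfolding lborel_prod[symmetric] by (rule lborel.emeasure_pair_measure_Times) (auto simp: I_def)
    also have "\<dots> = ennreal (1 / real q) * ennreal (1 / real q)"
      using q by (simp add: I_def diff_divide_distrib[symmetric] divide_right_mono)
    finally show ?thesis by (simp add: ennreal_mult[symmetric] power2_eq_square)
  qed
  have box: "integrable lborel (indicator (I j \<times> I k) :: _ \<Rightarrow> real)"
      "(LINT t|lborel. indicator (I j \<times> I k) t) = 1 / (real q)\<^sup>2" for j k
    using measure_box[of j k] by (simp_all add: I_def borel_closed closed_Times measure_def)
  have "(LINT t:{0..1} \<times> {0..1}|lborel. f t) \<le> (LINT t|lborel. (\<Sum>(j,k)\<in>B. w j k * indicator (I j \<times> I k) t))"
    unfolding set_lebesgue_integral_def
  proof (rule integral_mono)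
    show "integrable lborel (\<lambda>t. indicat_real ({0..1} \<times> {0..1}) t *\<^sub>R f t)"
      using f by (simp add: set_integrable_def)
    show "integrable lborel (\<lambda>t. \<Sum>(j,k)\<in>B. w j k * indicator (I j \<times> I k) t)"
      unfolding case_prod_unfold using box by (intro Bochner_Integration.integrable_sum integrable_mult_right) auto
    fix t :: "real \<times> real"
    have nonneg: "0 \<le> (\<Sum>(j,k)\<in>B. w j k * indicator (I j \<times> I k) t)"
      by (intro sum_nonneg) (auto simp: w)
    show "indicat_real ({0..1} \<times> {0..1}) t *\<^sub>R f t \<le> (\<Sum>(j,k)\<in>B. w j k * indicator (I j \<times> I k) t)"
    proof (cases "t \<in> {0..1} \<times> {0..1}")
      case True
      obtain j where j: "j < q" "fst t \<in> I j"
        using grid_interval_exists[OF q, of "fst t"] True by (auto simp: I_def)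
      obtain k where k: "k < q" "snd t \<in> I k"
        using grid_interval_exists[OF q, of "snd t"] True by (auto simp: I_def)
      have "f t \<le> w j k * indicator (I j \<times> I k) t"
        using le[of j k t] j k by (simp add: mem_Times_iff I_def)
      also have "\<dots> = (\<lambda>(j,k). w j k * indicator (I j \<times> I k) t) (j, k)" by simp
      also have "\<dots> \<le> (\<Sum>(j,k)\<in>B. w j k * indicator (I j \<times> I k) t)"
        by (rule member_le_sum) (use j k w in \<open>auto simp: B_def\<close>)
      finally show ?thesis using True by simp
    qed (use nonneg in simp)
  qed
  also have "\<dots> = (\<Sum>(j,k)\<in>B. w j k / (real q)\<^sup>2)"
    unfolding case_prod_unfold using box by (subst Bochner_Integration.integral_sum) auto
  also have "\<dots> = (\<Sum>j<q. \<Sum>k<q. w j k) / (real q)\<^sup>2"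
    unfolding B_def by (simp add: sum.cartesian_product sum_divide_distrib case_prod_unfold)
  finally show ?thesis .
qed

text \<open>This is \<open>1 + x \<le> exp x\<close> at \<open>x = y / p\<close>, raised to the power \<open>p\<close>.\<close>
lemma powr_le_exp:
  assumes "0 \<le> y" "0 < p"
  shows "y powr p \<le> p powr p * exp (y::real)"
proof -
  have "y \<le> p * exp (y / p)"
    using exp_ge_add_one_self[of "y / p"] assms by (simp add: field_simps)
  then have "y powr p \<le> (p * exp (y / p)) powr p"
    using assms by (intro powr_mono2) auto
  also have "\<dots> = p powr p * exp y"
    using assms by (simp add: powr_mult exp_powr_real)
  finally show ?thesis .
qed

text \<open>The constant \<open>7 * b\<^sup>2\<close> collects the rounding error \<open>6 * b\<^sup>2\<close>, the difference between the
  excess and its corrected version, and the normalization \<open>2 * b * sqrt m\<close>, while \<open>p\<close> and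
  \<open>2 * exp 2\<close> come from bounding the \<open>p\<close>-th power by an exponential and from the two exponential
  moments.\<close>
lemma Lp_disc_sym_hammersley_le:
  assumes b: "2 \<le> b" and p: "1 \<le> p" and m: "1 \<le> m"
  shows "Lp_disc p (sym_hammersley b m) \<le>
    7 * (real b)\<^sup>2 * p * (2 * exp 2) powr (1 / p) * (sqrt (real m) / real b ^ (m + 2))"
proof -
  \<comment> \<open>\<open>z\<close> is the normalized corrected excess and \<open>M * (\<bar>z\<bar> + 1)\<close> bounds the local discrepancy on a grid cell.\<close>
  define M where "M = 7 * (real b)\<^sup>2 * sqrt (real m) / real b ^ (m + 2)"
  define z where "z j k = corrected_excess b m j k / (2 * real b * sqrt (real m))" for j k
  define w where "w j k = (M * p) powr p * exp 1 * (exp (z j k) + exp (- z j k))" for j k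
  have M0: "0 < M" using b m by (simp add: M_def)
  have sq: "1 \<le> sqrt (real m)" using m by simp
  have le: "\<bar>local_disc (sym_hammersley b m) t\<bar> powr p \<le> w j k"
    if jk: "j < b ^ m" "k < b ^ m" and
      t: "t \<in> {real j / real (b ^ m)..real (j + 1) / real (b ^ m)} \<times> {real k / real (b ^ m)..real (k + 1) / real (b ^ m)}"
    for j k t
  proof -
    have "real b ^ (m + 2) * \<bar>local_disc (sym_hammersley b m) t\<bar> \<le> real b * \<bar>excess b m j k\<bar> + 6 * (real b)\<^sup>2"
      by (rule abs_local_disc_le_on_box) (use b jk t in auto)
    also have "\<dots> \<le> real b * (\<bar>corrected_excess b m j k\<bar> + real b / 2) + 6 * (real b)\<^sup>2"
      using abs_excess_le[of b k m j] b jk by (intro add_right_mono mult_left_mono) auto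
    also have "\<bar>corrected_excess b m j k\<bar> = \<bar>z j k\<bar> * (2 * real b * sqrt (real m))"
      using b m by (simp add: z_def abs_mult)
    also have "real b * (\<bar>z j k\<bar> * (2 * real b * sqrt (real m)) + real b / 2) + 6 * (real b)\<^sup>2 =
        (real b)\<^sup>2 * (2 * (\<bar>z j k\<bar> * sqrt (real m)) + 13 / 2)"
      by (simp add: power2_eq_square algebra_simps)
    also have "\<dots> \<le> (real b)\<^sup>2 * (7 * (\<bar>z j k\<bar> * sqrt (real m)) + 7 * sqrt (real m))"
    proof (rule mult_left_mono)
      have "0 \<le> \<bar>z j k\<bar> * sqrt (real m)" by simp
      then show "2 * (\<bar>z j k\<bar> * sqrt (real m)) + 13 / 2 \<le> 7 * (\<bar>z j k\<bar> * sqrt (real m)) + 7 * sqrt (real m)"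
        using sq by linarith
    qed simp
    also have "\<dots> = real b ^ (m + 2) * (M * (\<bar>z j k\<bar> + 1))"
    proof -
      have "real b ^ (m + 2) * M = 7 * (real b)\<^sup>2 * sqrt (real m)"
        using b by (simp add: M_def)
      then show ?thesis by (simp add: mult.assoc[symmetric]) (simp add: algebra_simps)
    qed
    finally have "\<bar>local_disc (sym_hammersley b m) t\<bar> \<le> M * (\<bar>z j k\<bar> + 1)"
      using b by simp
    then have "\<bar>local_disc (sym_hammersley b m) t\<bar> powr p \<le> (M * (\<bar>z j k\<bar> + 1)) powr p"
      using p by (intro powr_mono2) auto
    also have "\<dots> = M powr p * (\<bar>z j k\<bar> + 1) powr p"
      using M0 by (simp add: powr_mult)
    also have "\<dots> \<le> M powr p * (p powr p * exp (\<bar>z j k\<bar> + 1))"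
      using p by (intro mult_left_mono powr_le_exp) auto
    also have "\<dots> = (M * p) powr p * exp 1 * exp \<bar>z j k\<bar>"
      using M0 p by (simp add: powr_mult exp_add)
    also have "\<dots> \<le> w j k"
      unfolding w_def by (intro mult_left_mono) (auto simp: abs_if)
    finally show ?thesis .
  qed
  have "(LINT t:{0..1} \<times> {0..1}|lborel. \<bar>local_disc (sym_hammersley b m) t\<bar> powr p)
      \<le> (\<Sum>j<b^m. \<Sum>k<b^m. w j k) / (real (b ^ m))\<^sup>2"
    by (rule unit_square_integral_le_grid_average)
       (use b p le in \<open>auto simp: w_def intro!: set_integrable_local_disc\<close>)
  also have "(\<Sum>j<b^m. \<Sum>k<b^m. w j k) = (M * p) powr p * exp 1 *
      ((\<Sum>j<b^m. \<Sum>k<b^m. exp (z j k)) + (\<Sum>j<b^m. \<Sum>k<b^m. exp (- z j k)))"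
    by (simp add: w_def sum_distrib_left sum.distrib distrib_left)
  also have "\<dots> / (real (b ^ m))\<^sup>2 \<le> (M * p) powr p * exp 1 *
      ((real b ^ m)\<^sup>2 * exp 1 + (real b ^ m)\<^sup>2 * exp 1) / (real (b ^ m))\<^sup>2"
    using sum_exp_normalized_le[of b m 1] sum_exp_normalized_le[of b m "-1"] b m
    by (intro divide_right_mono mult_left_mono add_mono) (simp_all add: z_def)
  also have "\<dots> = (M * p) powr p * (2 * exp 2)"
    using b by (simp add: field_simps mult_exp_exp)
  finally have "Lp_disc p (sym_hammersley b m) \<le> ((M * p) powr p * (2 * exp 2)) powr (1 / p)"
    unfolding Lp_disc_def using p
    by (intro powr_mono2) (auto simp: set_lebesgue_integral_def intro!: integral_nonneg)
  also have "\<dots> = M * p * (2 * exp 2) powr (1 / p)"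
    using M0 p by (simp add: powr_mult powr_powr)
  finally show ?thesis by (simp add: M_def mult_ac)
qed

theorem theorem24:
  fixes b :: nat and p :: real
  assumes "prime b" and "1 \<le> p"
  shows "\<exists>C>0. \<forall>m::nat. 1 \<le> m \<longrightarrow>
    (let P = sym_hammersley b m; N = size P in
       N = b ^ (m+2)
       \<and> Lp_disc p P \<le> C * (sqrt (real (m+2)) / real b ^ (m+2))
       \<and> C * (sqrt (real (m+2)) / real b ^ (m+2))
           = C * (sqrt (log (real b) (real N)) / real N))"
proof -
  have b: "2 \<le> b" using assms(1) by (rule prime_ge_2_nat)
  define C where "C = 7 * (real b)\<^sup>2 * p * (2 * exp 2) powr (1 / p)"
  have "0 < C" using b assms(2) by (simp add: C_def)
  have "Lp_disc p (sym_hammersley b m) \<le> C * (sqrt (real (m+2)) / real b ^ (m+2))" if "1 \<le> m" for m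
  proof -
    have "Lp_disc p (sym_hammersley b m) \<le> C * (sqrt (real m) / real b ^ (m+2))"
      unfolding C_def using b assms(2) that by (rule Lp_disc_sym_hammersley_le)
    also have "\<dots> \<le> C * (sqrt (real (m+2)) / real b ^ (m+2))"
      using \<open>0 < C\<close> by (intro mult_left_mono divide_right_mono) auto
    finally show ?thesis .
  qed
  note bound = this
  have log: "log (real b) (real (b ^ (m+2))) = real (m+2)" for m
    using b by (simp only: of_nat_power log_pow_cancel)
  show ?thesis
  proof (intro exI[of _ C] conjI allI impI)
    fix m :: nat assume "1 \<le> m"
    then show "let P = sym_hammersley b m; N = size P in
       N = b ^ (m+2)
       \<and> Lp_disc p P \<le> C * (sqrt (real (m+2)) / real b ^ (m+2))
       \<and> C * (sqrt (real (m+2)) / real b ^ (m+2))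
           = C * (sqrt (log (real b) (real N)) / real N)"
      using bound[of m] log[of m]
      unfolding Let_def size_sym_hammersley by (simp only: of_nat_power simp_thms)
  qed (rule \<open>0 < C\<close>)
qed

end
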